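(* Let $\Sigma$ be an alphabet and let $L \subseteq \Sigma^*$ be a regular language. Then $L$ has a finite separating set of factors if and only if there do not exist words $w, x, y, z \in \Sigma^*$ with $wy \neq yw$ such that $x w^* y w^* z \subseteq L$.
   Context: For words $w, x$, $|w|_x$ denotes the number of occurrences of $x$ as a factor of $w$, i.e. the number of pairs of words $(s,t)$ with $w = sxt$ (so $|w|_\varepsilon = |w|+1$). A language $X$ is a separating set of factors (SSF) of a language $L$ if for all distinct $u, v \in L$ there exists $x \in X$ with $|u|_x \neq |v|_x$. *)

theory Defs
  imports Main
begin

definition word_pow :: "'a list \<Rightarrow> nat \<Rightarrow> 'a list" where
  "word_pow w n = concat (replicate n w)"

definition factor_count :: "'a list \<Rightarrow> 'a list \<Rightarrow> nat" where
  "factor_count w x = card {(s, t). w = s @ x @ t}"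

definition separating_set_of_factors :: "'a list set \<Rightarrow> 'a list set \<Rightarrow> bool" where
  "separating_set_of_factors X L \<longleftrightarrow>
     (\<forall>u\<in>L. \<forall>v\<in>L. u \<noteq> v \<longrightarrow> (\<exists>x\<in>X. factor_count u x \<noteq> factor_count v x))"

text \<open>Recognizability by a complete deterministic finite automaton over the alphabet \<open>\<Sigma>\<close>.
  Taking the states to be natural numbers is no restriction, since every finite state set can be
  renamed injectively into \<open>nat\<close>.\<close>
definition regular_language :: "'a set \<Rightarrow> 'a list set \<Rightarrow> bool" where
  "regular_language \<Sigma> L \<longleftrightarrow>
     (\<exists>(Q :: nat set) q0 F \<delta>.
        finite Q \<and> q0 \<in> Q \<and> F \<subseteq> Q \<and> (\<forall>q\<in>Q. \<forall>a\<in>\<Sigma>. \<delta> q a \<in> Q) \<and>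
        L = {u \<in> lists \<Sigma>. foldl \<delta> q0 u \<in> F})"

end

theory Submission
  imports Defs "HOL-Library.Sublist"
begin

text \<open>
  If \<open>x w\<^sup>* y w\<^sup>* z \<subseteq> L\<close> with \<open>wy \<noteq> yw\<close>, then \<open>x w\<^sup>N y w\<^sup>N w z\<close> and \<open>x w\<^sup>N w y w\<^sup>N z\<close> are distinct,
  but every factor of length at most \<open>N\<close> occurs equally often in them.

  Conversely, let an automaton with \<open>n\<close> states recognize \<open>L\<close>, put \<open>K = 2n\<^sup>2\<close>, and suppose that a
  word \<open>p\<close> of length \<open>K\<close> occurs at positions \<open>i < j\<close> of some \<open>u \<in> L\<close>. While the two occurrences are
  read in parallel, some pair of states repeats, so \<open>p\<close> has a factor \<open>w\<close> of length at most \<open>n\<^sup>2\<close>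
  that labels a loop in both places. If the pattern is excluded, \<open>w\<close> commutes with the word \<open>y\<close>
  between its two occurrences, and \<open>u[i, j + K)\<close> has a period of length at most
  \<open>n\<^sup>2 = K/2\<close>. Hence, in all words of \<open>L\<close>, every occurrence of \<open>p\<close> except the last one is followed
  by the same letter, which depends on \<open>p\<close> only. Two words of \<open>L\<close> with equal counts of all factors
  of length at most \<open>K + 1\<close> then cannot have a first difference.
\<close>

section \<open>Counting factors\<close>

lemma finite_factorizations: "finite {(s, t). w = s @ x @ t}"
proof (rule finite_subset)
  show "{(s, t). w = s @ x @ t} \<subseteq> set (prefixes w) \<times> set (suffixes w)"
    by (auto simp: suffix_def prefix_def)
qed simp

lemma factor_count_Nil: "factor_count [] x = (if x = [] then 1 else 0)"
proof -
  have "{(s, t). [] = s @ x @ t} = (if x = [] then {([], [])} else {})"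
    by auto
  then show ?thesis
    by (simp add: factor_count_def)
qed

lemma factor_count_Cons:
  "factor_count (a # u) x = (if prefix x (a # u) then 1 else 0) + factor_count u x"
proof -
  let ?A = "(\<lambda>(s, t). (a # s, t)) ` {(s, t). u = s @ x @ t}"
  let ?B = "if prefix x (a # u) then {([], drop (length x) (a # u))} else {}"
  have "{(s, t). a # u = s @ x @ t} = ?B \<union> ?A"
  proof (intro set_eqI iffI)
    fix q assume "q \<in> {(s, t). a # u = s @ x @ t}"
    then obtain s t where q: "q = (s, t)" "a # u = s @ x @ t"
      by auto
    show "q \<in> ?B \<union> ?A"
    proof (cases s)
      case Nil
      then show ?thesis
        using q by (auto simp: prefix_def)
    next
      case (Cons b s')
      then have "b = a" "u = s' @ x @ t"
        using q by auto
      then have "(a # s', t) \<in> ?A"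
        by (auto intro: image_eqI[of _ _ "(s', t)"])
      then show ?thesis
        using q Cons \<open>b = a\<close> by blast
    qed
  next
    fix q assume "q \<in> ?B \<union> ?A"
    then show "q \<in> {(s, t). a # u = s @ x @ t}"
      by (auto simp: prefix_def split: if_splits)
  qed
  moreover have "card ?A = factor_count u x"
    unfolding factor_count_def by (intro card_image) (auto simp: inj_on_def)
  moreover have "finite ?A"
    by (intro finite_imageI finite_factorizations)
  moreover have "?B \<inter> ?A = {}"
    by auto
  ultimately show ?thesis
    by (simp add: factor_count_def card_Un_disjoint)
qed

lemma factor_count_empty_word: "factor_count u [] = Suc (length u)"
  by (induction u) (simp_all add: factor_count_Nil factor_count_Cons)

text \<open>An occurrence of \<open>x\<close> inside neither \<open>a @ c\<close> nor
  \<open>c @ b\<close> would cover \<open>c\<close> and a letter on each side, which is too long;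
  one inside both lies in \<open>c\<close>. So counts can be computed by cutting a word at long
  factors \<open>c\<close>.\<close>

lemma factor_count_overlap:
  assumes "length x \<le> Suc (length c)"
  shows "factor_count (a @ c @ b) x + factor_count c x =
    factor_count (a @ c) x + factor_count (c @ b) x"
proof (induction a)
  case (Cons e a)
  have "prefix x ((e # a @ c) @ b) \<longleftrightarrow> prefix x (e # a @ c)"
    unfolding prefix_append using assms by (auto dest: prefix_length_le)
  then show ?case
    using Cons by (simp add: factor_count_Cons)
qed simp

text \<open>Every occurrence of \<open>p\<close> except one as a prefix has a letter before it. So
  the counts of \<open>p\<close> and of all \<open>a # p\<close> reveal whether \<open>p\<close> is
  a prefix.\<close>

lemma factor_count_split_prefix:
  assumes "finite \<Sigma>" and "u \<in> lists \<Sigma>"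
  shows "factor_count u p = (if prefix p u then 1 else 0) + (\<Sum>a\<in>\<Sigma>. factor_count u (a # p))"
  using assms(2)
proof (induction u)
  case Nil
  then show ?case
    by (simp add: factor_count_Nil)
next
  case (Cons e u)
  have "(\<Sum>a\<in>\<Sigma>. factor_count (e # u) (a # p)) =
      (\<Sum>a\<in>\<Sigma>. (if a = e then if prefix p u then 1 else 0 else 0) + factor_count u (a # p))"
    by (intro sum.cong) (auto simp: factor_count_Cons)
  also have "\<dots> = (if prefix p u then 1 else 0) + (\<Sum>a\<in>\<Sigma>. factor_count u (a # p))"
    using Cons.hyps assms(1) by (simp add: sum.distrib sum.delta)
  also have "\<dots> = factor_count u p"
    using Cons by simp
  finally show ?case
    by (simp add: factor_count_Cons)
qed

text \<open>Start positions, unlike factorizations, can be compared between different words. The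
  length bound matters for \<open>x = []\<close>, as \<open>drop k u\<close> is empty for all larger
  \<open>k\<close>.\<close>

definition occurrences :: "'a list \<Rightarrow> 'a list \<Rightarrow> nat set" where
  "occurrences u x = {k. k + length x \<le> length u \<and> take (length x) (drop k u) = x}"

lemma finite_occurrences: "finite (occurrences u x)"
  by (rule finite_subset[of _ "{..length u}"]) (auto simp: occurrences_def)

lemma factor_count_eq_card_occurrences: "factor_count u x = card (occurrences u x)"
proof -
  have "bij_betw (\<lambda>(s, t). length s) {(s, t). u = s @ x @ t} (occurrences u x)"
  proof (rule bij_betw_byWitness[where f' = "\<lambda>k. (take k u, drop (k + length x) u)"])
    have "u = take k u @ x @ drop (k + length x) u" if "k \<in> occurrences u x" for k
    proof -
      have "u = take k u @ take (length x) (drop k u) @ drop (length x) (drop k u)"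
        by (simp only: append_take_drop_id)
      also have "\<dots> = take k u @ x @ drop (k + length x) u"
        using that by (simp add: occurrences_def add.commute)
      finally show ?thesis .
    qed
    then show "(\<lambda>k. (take k u, drop (k + length x) u)) ` occurrences u x \<subseteq> {(s, t). u = s @ x @ t}"
      by auto
  qed (auto simp: occurrences_def)
  then show ?thesis
    unfolding factor_count_def by (rule bij_betw_same_card)
qed

lemma occurrence_nth:
  assumes "k \<in> occurrences u x" and "t < length x"
  shows "u ! (k + t) = x ! t"
proof -
  have "x ! t = take (length x) (drop k u) ! t" "k + length x \<le> length u"
    using assms by (auto simp: occurrences_def)
  then show ?thesis
    using assms(2) by simp
qed

lemma occurrences_appendD:
  assumes "k \<in> occurrences u (p @ q)"
  shows "k \<in> occurrences u p"
proof -
  have "take (length p) (take (length (p @ q)) (drop k u)) = take (length p) (p @ q)"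
    using assms by (simp only: occurrences_def mem_Collect_eq)
  then show ?thesis
    using assms by (simp add: occurrences_def min_def)
qed

section \<open>A pattern prevents a finite separating set\<close>

lemma word_pow_Suc: "word_pow w (Suc n) = w @ word_pow w n"
  by (simp add: word_pow_def)

lemma word_pow_Suc_right: "word_pow w (Suc n) = word_pow w n @ w"
  by (induction n) (simp_all add: word_pow_def)

lemma length_word_pow: "length (word_pow w n) = n * length w"
  by (induction n) (simp_all add: word_pow_def)

lemma pattern_imp_no_finite_separating_set:
  assumes "finite X" and "w @ y \<noteq> y @ w"
    and L: "{x @ word_pow w i @ y @ word_pow w j @ z | i j. True} \<subseteq> L"
  shows "\<not> separating_set_of_factors X L"
proof
  assume sep: "separating_set_of_factors X L"
  obtain N where N: "\<forall>f\<in>X. length f \<le> N"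
    using assms(1) by (meson finite_imageI finite_nat_set_iff_bounded_le image_eqI)
  define c where "c = word_pow w N"
  let ?u = "x @ c @ y @ word_pow w (Suc N) @ z"
  let ?v = "x @ word_pow w (Suc N) @ y @ c @ z"
  have wc: "word_pow w (Suc N) = w @ c" "word_pow w (Suc N) = c @ w"
    by (simp_all only: c_def word_pow_Suc flip: word_pow_Suc_right)
  then have comm: "c @ w = w @ c"
    by simp
  have "?u \<noteq> ?v"
  proof
    assume "?u = ?v"
    then have "x @ c @ (y @ w) @ c @ z = x @ c @ (w @ y) @ c @ z"
      by (subst (asm) wc(1), subst (asm) wc(2)) simp
    then show False
      using assms(2) by simp
  qed
  moreover have "?u \<in> L" "?v \<in> L"
    using L unfolding c_def by blast+
  ultimately obtain f where f: "f \<in> X" "factor_count ?u f \<noteq> factor_count ?v f"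
    using sep unfolding separating_set_of_factors_def by blast
  have "w \<noteq> []"
    using assms(2) by auto
  then have "N \<le> length c"
    by (simp add: c_def length_word_pow Suc_leI)
  then have "length f \<le> Suc (length c)"
    using N f(1) by (meson le_Suc_eq order_trans)
  note overlap = factor_count_overlap[OF this]
  have comm': "c @ w @ t = w @ c @ t" for t
    using comm by (metis append.assoc)
  \<comment> \<open>Cutting at the copies of \<open>c\<close>, which commutes with \<open>w\<close>,
    gives both words the same total: the counts of \<open>f\<close> in \<open>x @ c\<close>,
    \<open>c @ y @ c\<close>, \<open>w @ c\<close> and \<open>c @ z\<close>, minus three times that
    in \<open>c\<close>.\<close>
  have "factor_count ?u f = factor_count ?v f"
    using overlap[of x "y @ c @ w @ z"] overlap[of "c @ y" "w @ z"] overlap[of w z]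
      overlap[of "x @ w" "y @ c @ z"] overlap[of "c @ y" z] overlap[of x w]
    by (simp add: wc(1) comm comm')
  with f(2) show False
    by simp
qed

section \<open>Words determined by their factor counts\<close>

text \<open>By \<open>last\<close>, an occurrence of \<open>p @ [b]\<close> in \<open>u\<close>
  starts at most at \<open>length r\<close>, and not there, since \<open>a\<close> follows. So it
  lies in the common prefix \<open>r @ p\<close>, hence in \<open>v\<close>, which has one more at
  \<open>length r\<close>.\<close>

lemma first_difference_factor_count_less:
  assumes u: "u = r @ p @ a # u'" and v: "v = r @ p @ b # v'"
    and last: "\<And>k. k \<in> occurrences u p \<Longrightarrow> k \<le> length r"
    and "a \<noteq> b"
  shows "factor_count u (p @ [b]) < factor_count v (p @ [b])"
proof -
  have r: "length r \<in> occurrences v (p @ [b])"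
    by (simp add: v occurrences_def)
  have before: "k \<in> occurrences v (p @ [b]) \<and> k \<noteq> length r"
    if k: "k \<in> occurrences u (p @ [b])" for k
  proof -
    have "k \<le> length r"
      using last[OF occurrences_appendD[OF k]] .
    moreover have "k \<noteq> length r"
      using k \<open>a \<noteq> b\<close> by (auto simp: u occurrences_def)
    ultimately show ?thesis
      using k by (auto simp: u v occurrences_def)
  qed
  have "occurrences u (p @ [b]) \<subset> occurrences v (p @ [b])"
    using before r by blast
  then show ?thesis
    by (simp add: factor_count_eq_card_occurrences psubset_card_mono finite_occurrences)
qed

lemma eq_if_factor_counts_eq:
  assumes fin: "finite \<Sigma>" and uS: "u \<in> lists \<Sigma>" and vS: "v \<in> lists \<Sigma>"
    and counts: "\<And>x. x \<in> lists \<Sigma> \<Longrightarrow> length x \<le> Suc K \<Longrightarrow> factor_count u x = factor_count v x"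
    and nextu: "\<And>p i j. \<lbrakk>length p = K; i \<in> occurrences u p; j \<in> occurrences u p; i < j\<rbrakk>
      \<Longrightarrow> u ! (i + K) = c p"
    and nextv: "\<And>p i j. \<lbrakk>length p = K; i \<in> occurrences v p; j \<in> occurrences v p; i < j\<rbrakk>
      \<Longrightarrow> v ! (i + K) = c p"
  shows "u = v"
proof (rule ccontr)
  assume "u \<noteq> v"
  have "length u = length v"
    using counts[of "[]"] by (simp add: factor_count_empty_word)
  with \<open>u \<noteq> v\<close> obtain s a u' b v' where ab: "a \<noteq> b" and uv: "u = s @ a # u'" "v = s @ b # v'"
    using same_length_different[of u v] by (metis append_Cons append_Nil)
  have "K \<le> length s"
  proof (rule ccontr)
    assume "\<not> K \<le> length s"
    \<comment> \<open>\<open>q\<close> is a prefix of \<open>u\<close> only, and every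
      \<open>e # q\<close> still has length at most \<open>Suc K\<close>, so splitting by the
      preceding letter contradicts the equal counts.\<close>
    define q where "q = s @ [a]"
    have q: "length q \<le> K" "q \<in> lists \<Sigma>" "prefix q u" "\<not> prefix q v"
      using \<open>\<not> K \<le> length s\<close> uS uv ab by (auto simp: q_def)
    have "factor_count u q = factor_count v q"
      using q by (intro counts) auto
    moreover have "(\<Sum>e\<in>\<Sigma>. factor_count u (e # q)) = (\<Sum>e\<in>\<Sigma>. factor_count v (e # q))"
      using q by (intro sum.cong counts) auto
    ultimately show False
      using factor_count_split_prefix[OF fin uS, of q] factor_count_split_prefix[OF fin vS, of q] q
      by simp
  qed
  then obtain r p where s: "s = r @ p" and p: "length p = K"
    by (metis append_take_drop_id diff_diff_cancel length_drop)
  have uv': "u = r @ p @ a # u'" "v = r @ p @ b # v'"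
    using uv s by auto
  have ru: "length r \<in> occurrences u p" and rv: "length r \<in> occurrences v p"
    by (auto simp: occurrences_def uv')
  have nth: "u ! (length r + K) = a" "v ! (length r + K) = b"
    using p by (auto simp: uv' nth_append)
  have "p \<in> lists \<Sigma>" "a \<in> \<Sigma>" "b \<in> \<Sigma>"
    using uS vS by (auto simp: uv')
  then have "factor_count u (p @ [b]) = factor_count v (p @ [b])"
       "factor_count v (p @ [a]) = factor_count u (p @ [a])"
    using p by (auto intro!: counts counts[symmetric])
  \<comment> \<open>If \<open>length r\<close> were the last position of \<open>p\<close> in either
    word, the counts of \<open>p @ [b]\<close> or \<open>p @ [a]\<close> would differ.\<close>
  then obtain k l where k: "k \<in> occurrences u p" "length r < k"
      and l: "l \<in> occurrences v p" "length r < l"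
    using first_difference_factor_count_less[OF uv' _ ab]
      first_difference_factor_count_less[OF uv'(2,1) _ ab[symmetric]]
    by (metis less_irrefl not_le)
  have "a = c p" "b = c p"
    using nextu[OF p ru k] nextv[OF p rv l] nth by auto
  with ab show False
    by simp
qed

section \<open>Repeated factors in a language without the pattern\<close>

text \<open>The theorem of Fine and Wilf in the form needed here: a short period \<open>g\<close>, valid on a window
  of length \<open>D + g\<close>, is transported by the long period \<open>D\<close>.\<close>

lemma period_extend:
  fixes f :: "nat \<Rightarrow> 'a"
  assumes D: "\<And>t. i \<le> t \<Longrightarrow> t < i + K \<Longrightarrow> f t = f (t + D)"
    and window: "\<And>t. a \<le> t \<Longrightarrow> t < a + D \<Longrightarrow> f t = f (t + g)"
    and "i \<le> a" "a + g \<le> i + K" "0 < D"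
    and "i \<le> t" "t + g < i + D + K"
  shows "f t = f (t + g)"
proof -
  have right: "f t = f (t + g)" if "a \<le> t" "t + g < i + D + K" for t
    using that
  proof (induction t rule: less_induct)
    case (less t)
    show ?case
    proof (cases "t < a + D")
      case False
      then have "f (t - D) = f (t - D + g)"
        using less.prems \<open>0 < D\<close> by (intro less.IH) auto
      moreover have "f (t - D) = f t"
        using False less.prems \<open>i \<le> a\<close> D[of "t - D"] by simp
      moreover have "f (t - D + g) = f (t + g)"
        using False less.prems \<open>i \<le> a\<close> D[of "t - D + g"] by simp
      ultimately show ?thesis
        by simp
    qed (use less.prems window in simp)
  qed
  show ?thesis
    using assms(6,7)
  \<comment> \<open>Left of \<open>a\<close>, adding \<open>D\<close> moves towards the settled
    part, and \<open>a + g \<le> i + K\<close> keeps both \<open>t\<close> and \<open>t + g\<close>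
    where \<open>D\<close> applies.\<close>
  proof (induction "a - t" arbitrary: t rule: less_induct)
    case less
    show ?case
    proof (cases "a \<le> t")
      case False
      then have "f (t + D) = f (t + D + g)"
        using less.prems \<open>0 < D\<close> \<open>a + g \<le> i + K\<close> by (intro less.hyps) auto
      moreover have "f t = f (t + D)"
        using False less.prems \<open>a + g \<le> i + K\<close> by (intro D) auto
      moreover have "f (t + g) = f (t + g + D)"
        using False less.prems \<open>a + g \<le> i + K\<close> by (intro D) auto
      ultimately show ?thesis
        by (simp add: ac_simps)
    qed (use less.prems right in simp)
  qed
qed

lemma foldl_word_pow: "foldl \<delta> q w = q \<Longrightarrow> foldl \<delta> q (word_pow w n) = q"
  by (induction n) (simp_all add: word_pow_def)

lemma foldl_closed:
  assumes "\<forall>q\<in>Q. \<forall>a\<in>\<Sigma>. \<delta> q a \<in> Q"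
  shows "q \<in> Q \<Longrightarrow> u \<in> lists \<Sigma> \<Longrightarrow> foldl \<delta> q u \<in> Q"
  using assms by (induction u arbitrary: q) auto

lemma word_pow_in_lists: "w \<in> lists A \<Longrightarrow> word_pow w n \<in> lists A"
  by (auto simp: word_pow_def)

lemma repeated_factor_period:
  assumes "finite Q" "q0 \<in> Q" and \<delta>: "\<forall>q\<in>Q. \<forall>a\<in>\<Sigma>. \<delta> q a \<in> Q"
    and u: "u \<in> lists \<Sigma>" "foldl \<delta> q0 u \<in> F"
    and no_pattern: "\<And>w x y z. \<lbrakk>w \<in> lists \<Sigma>; x \<in> lists \<Sigma>; y \<in> lists \<Sigma>; z \<in> lists \<Sigma>;
      \<And>m n. foldl \<delta> q0 (x @ word_pow w m @ y @ word_pow w n @ z) \<in> F\<rbrakk> \<Longrightarrow> w @ y = y @ w"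
    and i: "i \<in> occurrences u p" and j: "j \<in> occurrences u p" and "i < j"
    and p: "card Q * card Q \<le> length p"
  shows "\<exists>g>0. g \<le> card Q * card Q \<and> (\<forall>t. i \<le> t \<longrightarrow> t + g < j + length p \<longrightarrow> u ! t = u ! (t + g))"
proof -
  define D where "D = j - i"
  have "0 < D" and j_eq: "j = i + D"
    using \<open>i < j\<close> by (auto simp: D_def)
  have len: "i + D + length p \<le> length u"
    using j by (simp add: occurrences_def j_eq)
  have shift: "u ! t = u ! (t + D)" if "i \<le> t" "t < i + length p" for t
    using occurrence_nth[OF i, of "t - i"] occurrence_nth[OF j, of "t - i"] that
    by (simp add: j_eq add.commute)
  define st where "st t = foldl \<delta> q0 (take t u)" for t
  have st: "st t \<in> Q" for t
    unfolding st_def using \<open>q0 \<in> Q\<close> u by (intro foldl_closed[OF \<delta>]) (auto dest: in_set_takeD)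
  have st_drop: "foldl \<delta> (st s) (take l (drop s u)) = st (s + l)" for s l
    by (simp add: st_def take_add)
  \<comment> \<open>There is one more offset than there are pairs of states.\<close>
  have "\<not> inj_on (\<lambda>t. (st (i + t), st (j + t))) {..card Q * card Q}"
  proof (rule pigeonhole)
    have "(\<lambda>t. (st (i + t), st (j + t))) ` {..card Q * card Q} \<subseteq> Q \<times> Q"
      using st by auto
    from card_mono[OF _ this]
    have "card ((\<lambda>t. (st (i + t), st (j + t))) ` {..card Q * card Q}) \<le> card Q * card Q"
      using \<open>finite Q\<close> by (simp add: card_cartesian_product)
    then show "card ((\<lambda>t. (st (i + t), st (j + t))) ` {..card Q * card Q}) < card {..card Q * card Q}"
      by simp
  qed
  then obtain t1 t2 where t: "t1 < t2" "t2 \<le> card Q * card Q"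
      "st (i + t1) = st (i + t2)" "st (j + t1) = st (j + t2)"
    unfolding inj_on_def by (metis (no_types, lifting) Pair_inject atMost_iff linorder_neqE_nat)
  define g where "g = t2 - t1"
  define a where "a = i + t1"
  have g: "0 < g" "g \<le> card Q * card Q" and a: "i \<le> a" "a + g \<le> i + length p"
    using t p by (auto simp: g_def a_def)
  have loops: "st (a + g) = st a" "st (a + D + g) = st (a + D)"
    using t by (simp_all add: a_def g_def j_eq ac_simps)
  show ?thesis
  proof (cases "g \<le> D")
    \<comment> \<open>The two loops overlap, leaving no room for \<open>y\<close>; but then
      \<open>D < g\<close> is itself a short period on the whole range.\<close>
    case False
    then show ?thesis
      using \<open>0 < D\<close> g shift by (intro exI[of _ D]) (auto simp: j_eq)
  next
    case True
    define w where "w = take g (drop a u)"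
    define y where "y = take (D - g) (drop (a + g) u)"
    define x where "x = take a u"
    define z where "z = drop (a + D + g) u"
    have w': "w = take g (drop (a + D) u)"
    proof (rule nth_equalityI)
      show "length w = length (take g (drop (a + D) u))"
        using len a by (simp add: w_def)
    next
      fix s assume "s < length w"
      then show "w ! s = take g (drop (a + D) u) ! s"
        using shift[of "a + s"] len a by (simp add: w_def ac_simps)
    qed
    \<comment> \<open>Since \<open>w\<close> recurs at \<open>a + D\<close>, both products are
      windows of length \<open>D\<close> in \<open>u\<close>, \<open>g\<close> apart; their equality
      is the period \<open>g\<close> on the window starting at \<open>a\<close>.\<close>
    have wy: "w @ y = take D (drop a u)"
      using True take_add[of g "D - g" "drop a u"] by (simp add: w_def y_def add.commute)
    have yw: "y @ w = take D (drop (a + g) u)"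
      using True take_add[of "D - g" g "drop (a + g) u"] by (simp add: w' y_def ac_simps)
    have "foldl \<delta> q0 (x @ word_pow w m @ y @ word_pow w n @ z) \<in> F" for m n
    proof -
      have "foldl \<delta> q0 x = st a"
        by (simp add: x_def st_def)
      moreover have "foldl \<delta> (st a) w = st a"
        by (simp add: w_def st_drop loops)
      moreover have "foldl \<delta> (st a) y = st (a + D)"
        using st_drop[of "a + g" "D - g"] True loops by (simp add: y_def)
      moreover have "foldl \<delta> (st (a + D)) w = st (a + D)"
        by (simp add: w' st_drop loops)
      moreover have "foldl \<delta> (st (a + D)) z = foldl \<delta> q0 u"
      proof -
        have "foldl \<delta> (st (a + D + g)) z = foldl \<delta> q0 (take (a + D + g) u @ z)"
          by (simp only: st_def foldl_append)
        then show ?thesis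
          using loops by (simp add: z_def)
      qed
      ultimately show ?thesis
        using u by (simp add: foldl_word_pow)
    qed
    moreover have "w \<in> lists \<Sigma>" "x \<in> lists \<Sigma>" "y \<in> lists \<Sigma>" "z \<in> lists \<Sigma>"
      using u by (auto simp: w_def x_def y_def z_def dest!: in_set_takeD in_set_dropD)
    ultimately have comm: "take D (drop a u) = take D (drop (a + g) u)"
      using no_pattern[of w x y z] wy yw by simp
    have window: "u ! t = u ! (t + g)" if "a \<le> t" "t < a + D" for t
    proof -
      have "take D (drop a u) ! (t - a) = take D (drop (a + g) u) ! (t - a)"
        by (simp add: comm)
      then show ?thesis
        using that a len by (simp add: add.commute)
    qed
    have "u ! t = u ! (t + g)" if "i \<le> t" "t + g < j + length p" for t
      using period_extend[of i "length p" "(!) u" D a g t, OF shift window] that a \<open>0 < D\<close>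
      by (simp add: j_eq)
    then show ?thesis
      using g by blast
  qed
qed

section \<open>The letter following a repeated factor\<close>

definition small_period :: "nat \<Rightarrow> 'a list \<Rightarrow> nat \<Rightarrow> bool" where
  "small_period B p g \<longleftrightarrow> 0 < g \<and> g \<le> B \<and> (\<forall>t. t + g < length p \<longrightarrow> p ! t = p ! (t + g))"

text \<open>Since \<open>g + h \<le> 2 * B\<close>, position \<open>length p - g - h\<close> exists;
  shifting it by either period reaches the two positions compared. This is why \<open>K\<close> is
  twice \<open>B\<close>.\<close>

lemma small_periods_agree:
  assumes "small_period B p g" "small_period B p h" "2 * B \<le> length p"
  shows "p ! (length p - g) = p ! (length p - h)"
proof -
  have "p ! (length p - g - h) = p ! (length p - g - h + g)"
    using assms unfolding small_period_def by auto
  moreover have "p ! (length p - g - h) = p ! (length p - g - h + h)"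
    using assms unfolding small_period_def by auto
  moreover have "length p - g - h + g = length p - h" "length p - g - h + h = length p - g"
    using assms unfolding small_period_def by auto
  ultimately show ?thesis
    by simp
qed

theorem theorem3:
  fixes \<Sigma> :: "'a set" and L :: "'a list set"
  assumes "finite \<Sigma>"
    and "L \<subseteq> lists \<Sigma>"
    and "regular_language \<Sigma> L"
  shows "(\<exists>X. finite X \<and> X \<subseteq> lists \<Sigma> \<and> separating_set_of_factors X L) \<longleftrightarrow>
    \<not> (\<exists>w\<in>lists \<Sigma>. \<exists>x\<in>lists \<Sigma>. \<exists>y\<in>lists \<Sigma>. \<exists>z\<in>lists \<Sigma>.
        w @ y \<noteq> y @ w \<and> {x @ word_pow w i @ y @ word_pow w j @ z | i j. True} \<subseteq> L)"
    (is "?ssf \<longleftrightarrow> \<not> ?pattern")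
proof
  assume ?ssf
  then obtain X where X: "finite X" "separating_set_of_factors X L"
    by blast
  show "\<not> ?pattern"
    using pattern_imp_no_finite_separating_set[OF X(1)] X(2) by (intro notI) (elim bexE conjE, simp)
next
  assume no_pattern: "\<not> ?pattern"
  obtain Q :: "nat set" and q0 F \<delta> where fin: "finite Q" and q0: "q0 \<in> Q"
      and \<delta>: "\<forall>q\<in>Q. \<forall>a\<in>\<Sigma>. \<delta> q a \<in> Q" and L: "L = {u \<in> lists \<Sigma>. foldl \<delta> q0 u \<in> F}"
    using assms(3) unfolding regular_language_def by blast
  define B where "B = card Q * card Q"
  define K where "K = 2 * B"
  define X where "X = {x. set x \<subseteq> \<Sigma> \<and> length x \<le> Suc K}"
  \<comment> \<open>The period is chosen from \<open>p\<close> alone, so \<open>c\<close> serves all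
    words of \<open>L\<close>; \<open>small_periods_agree\<close> makes the choice harmless.\<close>
  define c where "c p = p ! (length p - (SOME g. small_period B p g))" for p :: "'a list"
  have comm: "w @ y = y @ w"
    if "w \<in> lists \<Sigma>" "x \<in> lists \<Sigma>" "y \<in> lists \<Sigma>" "z \<in> lists \<Sigma>"
      and F: "\<And>m n. foldl \<delta> q0 (x @ word_pow w m @ y @ word_pow w n @ z) \<in> F" for w x y z
  proof -
    have "x @ word_pow w m @ y @ word_pow w n @ z \<in> L" for m n
      using F[of m n] that(1-4) word_pow_in_lists[OF that(1)] by (simp add: L)
    then have "{x @ word_pow w i @ y @ word_pow w j @ z | i j. True} \<subseteq> L"
      by auto
    then show ?thesis
      using no_pattern that(1-4) by meson
  qed
  have follow: "u ! (i + K) = c p"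
    if "u \<in> L" "length p = K" and i: "i \<in> occurrences u p" and j: "j \<in> occurrences u p"
      and "i < j" for u p i j
  proof -
    have u: "u \<in> lists \<Sigma>" "foldl \<delta> q0 u \<in> F"
      using \<open>u \<in> L\<close> by (auto simp: L)
    have "\<exists>g>0. g \<le> card Q * card Q \<and>
        (\<forall>t. i \<le> t \<longrightarrow> t + g < j + length p \<longrightarrow> u ! t = u ! (t + g))"
    proof (rule repeated_factor_period[OF fin q0 \<delta> u])
      fix w x y z
      assume "w \<in> lists \<Sigma>" "x \<in> lists \<Sigma>" "y \<in> lists \<Sigma>" "z \<in> lists \<Sigma>"
        "\<And>m n. foldl \<delta> q0 (x @ word_pow w m @ y @ word_pow w n @ z) \<in> F"
      then show "w @ y = y @ w"
        by (rule comm)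
    qed (use i j \<open>i < j\<close> \<open>length p = K\<close> in \<open>auto simp: K_def B_def\<close>)
    then obtain g where g: "0 < g" "g \<le> B"
        and period: "\<And>t. i \<le> t \<Longrightarrow> t + g < j + K \<Longrightarrow> u ! t = u ! (t + g)"
      using \<open>length p = K\<close> by (auto simp: B_def)
    have "p ! t = p ! (t + g)" if "t + g < K" for t
      using period[of "i + t"] that \<open>i < j\<close> occurrence_nth[OF i, of t] occurrence_nth[OF i, of "t + g"]
        \<open>length p = K\<close> by (simp add: ac_simps)
    then have "small_period B p g"
      using g \<open>length p = K\<close> by (simp add: small_period_def)
    then have "c p = p ! (K - g)"
      unfolding c_def using \<open>length p = K\<close> small_periods_agree[of B p _ g]
      by (metis K_def order_refl someI_ex)
    also have "\<dots> = u ! (i + (K - g))"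
      using g \<open>length p = K\<close> occurrence_nth[OF i, of "K - g"] by (simp add: K_def)
    \<comment> \<open>As \<open>i < j\<close>, the range of the period \<open>g\<close> extends past
      the first occurrence of \<open>p\<close> and includes position \<open>i + K\<close>.\<close>
    also have "\<dots> = u ! (i + K)"
      using period[of "i + (K - g)"] g \<open>i < j\<close> by (simp add: K_def)
    finally show ?thesis
      by simp
  qed
  have "u = v" if "u \<in> L" "v \<in> L" "\<forall>x\<in>X. factor_count u x = factor_count v x" for u v
  proof (rule eq_if_factor_counts_eq[OF assms(1), where K = K and c = c])
    show "factor_count u x = factor_count v x" if "x \<in> lists \<Sigma>" "length x \<le> Suc K" for x
      using that \<open>\<forall>x\<in>X. factor_count u x = factor_count v x\<close> by (auto simp: X_def lists_eq_set)
  qed (use that follow assms(2) in auto)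
  then have "separating_set_of_factors X L"
    unfolding separating_set_of_factors_def by blast
  moreover have "finite X" "X \<subseteq> lists \<Sigma>"
    using finite_lists_length_le[OF assms(1)] by (auto simp: X_def)
  ultimately show ?ssf
    by blast
qed

end
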